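(* Let $n\in\{6,7,8\}$ and $N_1,\dots,N_n\geq 0$ be integers. Let $Q$ be the quiver with vertices $1,\dots,n$, arrows $x_3:1\to 3$, $x_4:3\to 4$, $x_2:4\to 2$, $x_i:i-1\to i$ for $5\le i\le n$, and $N_i$ loops at vertex $i$ for each $i$. Let $E(n)=\Bbbk Q/(\geq 2)$. Then $$\operatorname{fpd}\big(E(n)\text{-mod}\big)=\max\{N_1,\dots,N_n\}.$$
   Context: $\Bbbk$ is an algebraically closed field; $\Bbbk Q$ is the path algebra with $e_i\alpha=\delta_{i,t(\alpha)}\alpha$, $\alpha e_j=\delta_{j,s(\alpha)}\alpha$; $(\geq 2)$ is the ideal generated by paths of length $\geq 2$; $A\text{-mod}$ is the category of finite-dimensional left $A$-modules. For a $\Bbbk$-linear abelian category $\mathcal C$: an object $M$ is a brick if $\mathrm{Hom}(M,M)=\Bbbk$; a finite set $\phi=\{X_1,\dots,X_m\}$ of nonzero objects is a brick set if each $X_i$ is a brick and $\dim\mathrm{Hom}(X_i,X_j)=\delta_{ij}$; its adjacency matrix is $A(\phi)=(\dim\mathrm{Ext}^1_{\mathcal C}(X_i,X_j))_{i,j}$; and $\operatorname{fpd}(\mathcal C)=\sup_{\phi}\rho(A(\phi))$, the supremum over all brick sets of the spectral radius $\rho$. *)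

theory Defs
  imports "Jordan_Normal_Form.Spectral_Radius" "HOL-Library.Extended_Real" "HOL-Library.Function_Algebras"
begin

text \<open>Matrices are encoded by their entries (row, column), functions nat => nat => 'k.
  A representation of a bound quiver Q/(paths of length >= 2) with vertex set V,
  arrow set Ar, source s and target t is a pair (d, rho): d v is the dimension of the
  space at vertex v and rho a is the matrix (size d (t a) x d (s a)) of the arrow a.
  Finite-dimensional left modules over kQ/(>=2) are identified with such representations.\<close>

definition mmul :: "nat \<Rightarrow> (nat \<Rightarrow> nat \<Rightarrow> 'k::field) \<Rightarrow> (nat \<Rightarrow> nat \<Rightarrow> 'k) \<Rightarrow> nat \<Rightarrow> nat \<Rightarrow> 'k" where
  "mmul m A B = (\<lambda>i j. \<Sum>l<m. A i l * B l j)"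

definition supported :: "nat \<Rightarrow> nat \<Rightarrow> (nat \<Rightarrow> nat \<Rightarrow> 'k::zero) \<Rightarrow> bool" where
  "supported r c A \<longleftrightarrow> (\<forall>i j. (i \<ge> r \<or> j \<ge> c) \<longrightarrow> A i j = 0)"

type_synonym ('a, 'k) rep = "(nat \<Rightarrow> nat) \<times> ('a \<Rightarrow> nat \<Rightarrow> nat \<Rightarrow> 'k)"

definition is_rep :: "nat set \<Rightarrow> 'a set \<Rightarrow> ('a \<Rightarrow> nat) \<Rightarrow> ('a \<Rightarrow> nat) \<Rightarrow> ('a, 'k::field) rep \<Rightarrow> bool" where
  "is_rep V Ar s t M \<longleftrightarrow>
     (\<forall>v. v \<notin> V \<longrightarrow> fst M v = 0) \<and>
     (\<forall>a. a \<notin> Ar \<longrightarrow> snd M a = (\<lambda>i j. 0)) \<and>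
     (\<forall>a\<in>Ar. supported (fst M (t a)) (fst M (s a)) (snd M a)) \<and>
     (\<forall>a\<in>Ar. \<forall>b\<in>Ar. t a = s b \<longrightarrow> mmul (fst M (s b)) (snd M b) (snd M a) = (\<lambda>i j. 0))"

definition nonzero_rep :: "nat set \<Rightarrow> ('a, 'k) rep \<Rightarrow> bool" where
  "nonzero_rep V M \<longleftrightarrow> (\<exists>v\<in>V. fst M v \<noteq> 0)"

definition fscale :: "'k::field \<Rightarrow> ('x \<Rightarrow> nat \<Rightarrow> nat \<Rightarrow> 'k) \<Rightarrow> ('x \<Rightarrow> nat \<Rightarrow> nat \<Rightarrow> 'k)" where
  "fscale c f = (\<lambda>x i j. c * f x i j)"

definition kdim :: "('x \<Rightarrow> nat \<Rightarrow> nat \<Rightarrow> 'k::field) set \<Rightarrow> nat" where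
  "kdim S = vector_space.dim fscale S"

definition vfam :: "nat set \<Rightarrow> ('a, 'k::field) rep \<Rightarrow> ('a, 'k) rep \<Rightarrow> (nat \<Rightarrow> nat \<Rightarrow> nat \<Rightarrow> 'k) set" where
  "vfam V M N = {h. (\<forall>v. v \<notin> V \<longrightarrow> h v = (\<lambda>i j. 0)) \<and>
                    (\<forall>v\<in>V. supported (fst N v) (fst M v) (h v))}"

definition Hom_rep :: "nat set \<Rightarrow> 'a set \<Rightarrow> ('a \<Rightarrow> nat) \<Rightarrow> ('a \<Rightarrow> nat) \<Rightarrow> ('a, 'k::field) rep \<Rightarrow> ('a, 'k) rep
     \<Rightarrow> (nat \<Rightarrow> nat \<Rightarrow> nat \<Rightarrow> 'k) set" where
  "Hom_rep V Ar s t M N = {h \<in> vfam V M N.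
      \<forall>a\<in>Ar. mmul (fst N (s a)) (snd N a) (h (s a)) = mmul (fst M (t a)) (h (t a)) (snd M a)}"

definition dimHom :: "nat set \<Rightarrow> 'a set \<Rightarrow> ('a \<Rightarrow> nat) \<Rightarrow> ('a \<Rightarrow> nat) \<Rightarrow> ('a, 'k::field) rep \<Rightarrow> ('a, 'k) rep \<Rightarrow> nat" where
  "dimHom V Ar s t M N = kdim (Hom_rep V Ar s t M N)"

text \<open>Ext^1(M,N): extensions 0 -> N -> E -> M -> 0 are given by E_a = [[N_a, g_a],[0, M_a]]
  with g_a : M_(s a) -> N_(t a); E satisfies the relations iff N_b g_a + g_b M_a = 0 for all
  composable a, b. Ext^1(M,N) = Z / B, where B consists of the coboundaries
  g_a = N_a h_(s a) - h_(t a) M_a.\<close>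
definition afam :: "'a set \<Rightarrow> ('a \<Rightarrow> nat) \<Rightarrow> ('a \<Rightarrow> nat) \<Rightarrow> ('a, 'k::field) rep \<Rightarrow> ('a, 'k) rep \<Rightarrow> ('a \<Rightarrow> nat \<Rightarrow> nat \<Rightarrow> 'k) set" where
  "afam Ar s t M N = {g. (\<forall>a. a \<notin> Ar \<longrightarrow> g a = (\<lambda>i j. 0)) \<and>
                        (\<forall>a\<in>Ar. supported (fst N (t a)) (fst M (s a)) (g a))}"

definition Z1_rep :: "'a set \<Rightarrow> ('a \<Rightarrow> nat) \<Rightarrow> ('a \<Rightarrow> nat) \<Rightarrow> ('a, 'k::field) rep \<Rightarrow> ('a, 'k) rep \<Rightarrow> ('a \<Rightarrow> nat \<Rightarrow> nat \<Rightarrow> 'k) set" where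
  "Z1_rep Ar s t M N = {g \<in> afam Ar s t M N.
     \<forall>a\<in>Ar. \<forall>b\<in>Ar. t a = s b \<longrightarrow>
        (\<lambda>i j. mmul (fst N (s b)) (snd N b) (g a) i j + mmul (fst M (s b)) (g b) (snd M a) i j) = (\<lambda>i j. 0)}"

definition B1_rep :: "nat set \<Rightarrow> 'a set \<Rightarrow> ('a \<Rightarrow> nat) \<Rightarrow> ('a \<Rightarrow> nat) \<Rightarrow> ('a, 'k::field) rep \<Rightarrow> ('a, 'k) rep \<Rightarrow> ('a \<Rightarrow> nat \<Rightarrow> nat \<Rightarrow> 'k) set" where
  "B1_rep V Ar s t M N = (\<lambda>h. \<lambda>a i j. if a \<in> Ar then
        mmul (fst N (s a)) (snd N a) (h (s a)) i j - mmul (fst M (t a)) (h (t a)) (snd M a) i j else 0)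
      ` vfam V M N"

definition dimExt1 :: "nat set \<Rightarrow> 'a set \<Rightarrow> ('a \<Rightarrow> nat) \<Rightarrow> ('a \<Rightarrow> nat) \<Rightarrow> ('a, 'k::field) rep \<Rightarrow> ('a, 'k) rep \<Rightarrow> nat" where
  "dimExt1 V Ar s t M N = kdim (Z1_rep Ar s t M N) - kdim (B1_rep V Ar s t M N)"

definition is_brick :: "nat set \<Rightarrow> 'a set \<Rightarrow> ('a \<Rightarrow> nat) \<Rightarrow> ('a \<Rightarrow> nat) \<Rightarrow> ('a, 'k::field) rep \<Rightarrow> bool" where
  "is_brick V Ar s t M \<longleftrightarrow> is_rep V Ar s t M \<and> nonzero_rep V M \<and> dimHom V Ar s t M M = 1"

definition is_brick_set :: "nat set \<Rightarrow> 'a set \<Rightarrow> ('a \<Rightarrow> nat) \<Rightarrow> ('a \<Rightarrow> nat) \<Rightarrow> ('a, 'k::field) rep list \<Rightarrow> bool" where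
  "is_brick_set V Ar s t X \<longleftrightarrow> X \<noteq> [] \<and>
     (\<forall>i<length X. is_brick V Ar s t (X ! i)) \<and>
     (\<forall>i<length X. \<forall>j<length X. i \<noteq> j \<longrightarrow> dimHom V Ar s t (X ! i) (X ! j) = 0)"

definition adj_mat :: "nat set \<Rightarrow> 'a set \<Rightarrow> ('a \<Rightarrow> nat) \<Rightarrow> ('a \<Rightarrow> nat) \<Rightarrow> ('a, 'k::field) rep list \<Rightarrow> complex mat" where
  "adj_mat V Ar s t X = mat (length X) (length X) (\<lambda>(i, j). of_nat (dimExt1 V Ar s t (X ! i) (X ! j)))"

definition fpd :: "'k::field itself \<Rightarrow> nat set \<Rightarrow> 'a set \<Rightarrow> ('a \<Rightarrow> nat) \<Rightarrow> ('a \<Rightarrow> nat) \<Rightarrow> ereal" where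
  "fpd _ V Ar s t = (SUP X \<in> {X :: ('a, 'k) rep list. is_brick_set V Ar s t X}.
                        ereal (spectral_radius (adj_mat V Ar s t X)))"

text \<open>The quiver of E(n): vertices 1..n; arrow (i,0) is x_i (2 <= i <= n), with
  x_2 : 4 -> 2, x_3 : 1 -> 3, x_4 : 3 -> 4, x_i : i-1 -> i (i >= 5);
  arrow (i, k+1) (k < N i) is the k-th loop at vertex i.\<close>
definition E_verts :: "nat \<Rightarrow> nat set" where "E_verts n = {1..n}"

definition E_arrows :: "nat \<Rightarrow> (nat \<Rightarrow> nat) \<Rightarrow> (nat \<times> nat) set" where
  "E_arrows n N = {(i, 0) | i. 2 \<le> i \<and> i \<le> n} \<union> {(i, Suc k) | i k. 1 \<le> i \<and> i \<le> n \<and> k < N i}"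

definition E_src :: "nat \<times> nat \<Rightarrow> nat" where
  "E_src a = (case a of (i, 0) \<Rightarrow> (if i = 2 then 4 else if i = 3 then 1 else if i = 4 then 3 else i - 1)
                      | (i, Suc k) \<Rightarrow> i)"

definition E_tgt :: "nat \<times> nat \<Rightarrow> nat" where
  "E_tgt a = fst a"

end

theory Submission
  imports Defs
begin

text \<open>
  A homomorphism can be built from any functional on the top and any vector in the socle of the same
  vertex space. Hence in a non-simple brick no vertex carries both top and socle, all loops act by zero,
  and every vertex is either a source or a sink. Connectedness and the fact that a vertex has at most
  two outgoing edges leave only the simple modules and the modules with a one-dimensional top p and
  one-dimensional socles at some children of p. For orthogonal bricks M, N of this kind with tops
  p, q, a nonzero extension group Ext(M, N) forces q to lie one level below p, and self-extensions
  exist only for the simple modules, where they are counted by the loops. So the adjacency matrix is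
  triangular with diagonal entries among 0 and the N i.
\<close>

section \<open>Linear algebra\<close>

text \<open>Without its loops the quiver is a tree rooted at vertex 1, and every other vertex has
  exactly one incoming edge. A sink therefore has a single neighbour, its parent, so a connected
  source-sink pattern is one source with some of its children. With at most two children this star
  has type A_1, A_2 or A_3, where bricks have dimension at most 1 at each vertex; a third child
  would give D_4, which has a brick of dimension 2 at the centre.

  For distinct tops, orthogonality keeps each top out of the socle of the other module, and the
  square-zero relations kill cocycles on edges that leave a socle vertex of the first module. Only
  the edge from \<open>p\<close> to \<open>q\<close> can carry a class. Equal tops are the case
  where nonzero cocycles remain and must be shown to be coboundaries.\<close>

lemma kernel_subset_imp_row_combination:
  fixes A :: "nat \<Rightarrow> nat \<Rightarrow> 'k::field" and \<alpha> :: "nat \<Rightarrow> 'k"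
  assumes "\<And>w. (\<And>i. i < m \<Longrightarrow> (\<Sum>l<n. A i l * w l) = 0) \<Longrightarrow> (\<Sum>l<n. \<alpha> l * w l) = 0"
  shows "\<exists>\<beta>. \<forall>l<n. \<alpha> l = (\<Sum>i<m. \<beta> i * A i l)"
  using assms
proof (induction m arbitrary: \<alpha>)
  case 0
  have "\<alpha> l = 0" if "l < n" for l
    using 0[of "\<lambda>j. if j = l then 1 else 0"] that
    by (simp add: if_distrib[of "\<lambda>x. _ * x"] cong: if_cong)
  then show ?case by simp
next
  case (Suc m)
  show ?case
  proof (cases "\<exists>w. (\<forall>i<m. (\<Sum>l<n. A i l * w l) = 0) \<and> (\<Sum>l<n. A m l * w l) \<noteq> 0")
    case True
    then obtain w where w: "\<And>i. i < m \<Longrightarrow> (\<Sum>l<n. A i l * w l) = 0"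
      and wm: "(\<Sum>l<n. A m l * w l) \<noteq> 0" by blast
    \<comment> \<open>\<open>w\<close> is killed by the first \<open>m\<close> rows but not by row
      \<open>m\<close>; \<open>c\<close> makes \<open>\<alpha> - c * A m\<close> vanish on
      \<open>w\<close>.\<close>
    define c where "c = (\<Sum>l<n. \<alpha> l * w l) / (\<Sum>l<n. A m l * w l)"
    have "\<exists>\<beta>. \<forall>l<n. \<alpha> l - c * A m l = (\<Sum>i<m. \<beta> i * A i l)"
    proof (rule Suc.IH)
      fix u assume u: "\<And>i. i < m \<Longrightarrow> (\<Sum>l<n. A i l * u l) = 0"
      \<comment> \<open>Subtracting \<open>e * w\<close> moves \<open>u\<close> into the kernel of
        row \<open>m\<close> too, where the hypothesis on \<open>\<alpha>\<close> applies.\<close>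
      define e where "e = (\<Sum>l<n. A m l * u l) / (\<Sum>l<n. A m l * w l)"
      have split: "(\<Sum>l<n. f l * (u l - e * w l)) = (\<Sum>l<n. f l * u l) - e * (\<Sum>l<n. f l * w l)" for f
        by (simp add: algebra_simps sum_subtractf sum_distrib_left)
      have "(\<Sum>l<n. A i l * (u l - e * w l)) = 0" if "i < Suc m" for i
        using that u[of i] w[of i] wm unfolding split by (cases "i = m") (auto simp: e_def)
      then have "(\<Sum>l<n. \<alpha> l * (u l - e * w l)) = 0" by (rule Suc.prems)
      then have "(\<Sum>l<n. \<alpha> l * u l) = e * (\<Sum>l<n. \<alpha> l * w l)" unfolding split by simp
      moreover have "(\<Sum>l<n. (\<alpha> l - c * A m l) * u l)
          = (\<Sum>l<n. \<alpha> l * u l) - c * (\<Sum>l<n. A m l * u l)"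
        by (simp add: left_diff_distrib sum_subtractf sum_distrib_left mult.assoc)
      ultimately show "(\<Sum>l<n. (\<alpha> l - c * A m l) * u l) = 0" by (simp add: c_def e_def)
    qed
    then obtain \<beta> where \<beta>: "\<forall>l<n. \<alpha> l - c * A m l = (\<Sum>i<m. \<beta> i * A i l)" by blast
    show ?thesis
    proof (intro exI allI impI)
      fix l assume "l < n"
      then have "\<alpha> l = (\<Sum>i<m. \<beta> i * A i l) + c * A m l" using \<beta> by (simp add: algebra_simps)
      then show "\<alpha> l = (\<Sum>i<Suc m. (\<beta>(m := c)) i * A i l)" by simp
    qed
  next
    case False
    then have "\<exists>\<beta>. \<forall>l<n. \<alpha> l = (\<Sum>i<m. \<beta> i * A i l)"
      by (intro Suc.IH Suc.prems) (metis less_Suc_eq)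
    then obtain \<beta> where "\<forall>l<n. \<alpha> l = (\<Sum>i<m. \<beta> i * A i l)" by blast
    then show ?thesis by (intro exI[of _ "\<beta>(m := 0)"]) simp
  qed
qed

text \<open>In an eigenvector, choose a nonzero coordinate \<open>i\<close> with \<open>f i\<close>
  maximal. Nonzero off-diagonal entries of row \<open>i\<close> only meet coordinates of larger
  grade, which vanish, so the eigenvalue is \<open>A $$ (i, i)\<close>. The grading stands in for
  triangular form and saves reordering the brick set.\<close>

lemma spectral_radius_le_of_graded:
  fixes A :: "complex mat" and f :: "nat \<Rightarrow> nat"
  assumes A: "A \<in> carrier_mat m m" and m: "0 < m"
    and diag: "\<And>i. i < m \<Longrightarrow> norm (A $$ (i, i)) \<le> r"
    and off: "\<And>i j. i < m \<Longrightarrow> j < m \<Longrightarrow> i \<noteq> j \<Longrightarrow> A $$ (i, j) \<noteq> 0 \<Longrightarrow> f i < f j"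
  shows "spectral_radius A \<le> r"
proof -
  obtain ev where ev: "ev \<in> spectrum A" and sr: "spectral_radius A = norm ev"
    using spectral_radius_mem_max(1)[OF A m] by auto
  from ev obtain v where "eigenvector A v ev"
    by (auto simp: spectrum_def eigenvalue_def)
  then have v: "v \<in> carrier_vec m" "v \<noteq> 0\<^sub>v m" "A *\<^sub>v v = ev \<cdot>\<^sub>v v"
    using A by (auto simp: eigenvector_def)
  define S where "S = {i. i < m \<and> v $ i \<noteq> 0}"
  have "S \<noteq> {}" "finite S" using v(1,2) by (auto simp: S_def intro!: eq_vecI)
  then obtain i where iS: "i \<in> S" and "f i = Max (f ` S)"
    by (metis (no_types, lifting) Max_in finite_imageI imageE image_is_empty)
  then have imax: "f j \<le> f i" if "j \<in> S" for j using \<open>finite S\<close> that by simp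
  from iS have i: "i < m" "v $ i \<noteq> 0" by (auto simp: S_def)
  have "A $$ (i, j) * v $ j = 0" if "j < m" "j \<noteq> i" for j
    using off[of i j] imax[of j] that i(1) by (force simp: S_def)
  then have "(\<Sum>j\<in>{0..<m}. A $$ (i, j) * v $ j) = (\<Sum>j\<in>{i}. A $$ (i, j) * v $ j)"
    using i(1) by (intro sum.mono_neutral_right) auto
  moreover have "(A *\<^sub>v v) $ i = (\<Sum>j\<in>{0..<m}. A $$ (i, j) * v $ j)"
    using A v(1) i(1) by (simp add: scalar_prod_def)
  ultimately have "A $$ (i, i) * v $ i = ev * v $ i" using v i(1) by auto
  then have "A $$ (i, i) = ev" using i(2) by simp
  then show ?thesis using diag[OF i(1)] sr by simp
qed

section \<open>Dimensions of spaces of matrix families\<close>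

interpretation fscale: vector_space "fscale :: 'k::field \<Rightarrow> ('x \<Rightarrow> nat \<Rightarrow> nat \<Rightarrow> 'k) \<Rightarrow> _"
  by unfold_locales (simp_all add: fscale_def fun_eq_iff algebra_simps)

definition funit :: "'x \<times> nat \<times> nat \<Rightarrow> 'x \<Rightarrow> nat \<Rightarrow> nat \<Rightarrow> 'k::field" where
  "funit p = (\<lambda>x i j. if (x, i, j) = p then 1 else 0)"

lemma sum_fscale_funit_apply:
  assumes "finite K"
  shows "(\<Sum>p\<in>K. fscale (c p) (funit p)) x i j = (if (x, i, j) \<in> K then c (x, i, j) else 0)"
proof -
  have "(\<Sum>p\<in>K. fscale (c p) (funit p)) x i j = (\<Sum>p\<in>K. fscale (c p) (funit p) x i j)"
    using assms by induction simp_all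
  also have "\<dots> = (\<Sum>p\<in>K. if p = (x, i, j) then c p else 0)"
    by (intro sum.cong) (auto simp: fscale_def funit_def)
  finally show ?thesis using assms by simp
qed

lemma fsupp_subset_span:
  fixes S :: "('x \<Rightarrow> nat \<Rightarrow> nat \<Rightarrow> 'k::field) set"
  assumes "finite K" and "\<And>h x i j. h \<in> S \<Longrightarrow> (x, i, j) \<notin> K \<Longrightarrow> h x i j = 0"
  shows "S \<subseteq> fscale.span (funit ` K)"
proof
  fix h assume "h \<in> S"
  then have "h = (\<Sum>p\<in>K. fscale (case p of (x, i, j) \<Rightarrow> h x i j) (funit p))"
    using assms by (auto simp: fun_eq_iff sum_fscale_funit_apply)
  also have "\<dots> \<in> fscale.span (funit ` K)"
    by (intro fscale.span_sum fscale.span_scale fscale.span_base) auto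
  finally show "h \<in> fscale.span (funit ` K)" .
qed

lemma kdim_fsupp_le:
  fixes S :: "('x \<Rightarrow> nat \<Rightarrow> nat \<Rightarrow> 'k::field) set"
  assumes "finite K" and "\<And>h x i j. h \<in> S \<Longrightarrow> (x, i, j) \<notin> K \<Longrightarrow> h x i j = 0"
  shows "kdim S \<le> card K"
proof -
  have "kdim S \<le> card (funit ` K :: ('x \<Rightarrow> nat \<Rightarrow> nat \<Rightarrow> 'k) set)"
    unfolding kdim_def using assms by (intro fscale.dim_le_card fsupp_subset_span) auto
  also have "\<dots> \<le> card K" by (rule card_image_le[OF assms(1)])
  finally show ?thesis .
qed

lemma kdim_fsupp:
  fixes K :: "('x \<times> nat \<times> nat) set"
  assumes K: "finite K"
  shows "kdim {h :: 'x \<Rightarrow> nat \<Rightarrow> nat \<Rightarrow> 'k::field. \<forall>x i j. (x, i, j) \<notin> K \<longrightarrow> h x i j = 0} = card K"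
    (is "kdim ?S = _")
proof -
  have inj: "inj_on (funit :: _ \<Rightarrow> 'x \<Rightarrow> nat \<Rightarrow> nat \<Rightarrow> 'k) K"
  proof (rule inj_onI)
    fix p q :: "'x \<times> nat \<times> nat"
    assume "funit p = (funit q :: 'x \<Rightarrow> nat \<Rightarrow> nat \<Rightarrow> 'k)"
    then have "funit p (fst p) (fst (snd p)) (snd (snd p))
        = (funit q (fst p) (fst (snd p)) (snd (snd p)) :: 'k)" by simp
    then show "p = q" by (simp add: funit_def split: if_splits)
  qed
  have indep: "fscale.independent (funit ` K :: ('x \<Rightarrow> nat \<Rightarrow> nat \<Rightarrow> 'k) set)"
  proof (rule fscale.independent_if_scalars_zero)
    show "finite (funit ` K)" using K by simp
    fix c :: "('x \<Rightarrow> nat \<Rightarrow> nat \<Rightarrow> 'k) \<Rightarrow> 'k" and u :: "'x \<Rightarrow> nat \<Rightarrow> nat \<Rightarrow> 'k"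
    assume "(\<Sum>u\<in>funit ` K. fscale (c u) u) = 0" and "u \<in> funit ` K"
    then obtain x i j where *: "(\<Sum>p\<in>K. fscale (c (funit p)) (funit p)) = 0"
        and u: "u = funit (x, i, j)" "(x, i, j) \<in> K"
      by (auto simp: sum.reindex[OF inj])
    from * have "(\<Sum>p\<in>K. fscale (c (funit p)) (funit p)) x i j = 0" by simp
    then show "c u = 0" using u by (simp add: sum_fscale_funit_apply[OF K])
  qed
  show ?thesis unfolding kdim_def
  proof (rule fscale.dim_unique[OF _ _ indep])
    show "funit ` K \<subseteq> ?S" by (auto simp: funit_def)
    show "?S \<subseteq> fscale.span (funit ` K)" by (rule fsupp_subset_span[OF K]) auto
    show "card (funit ` K :: ('x \<Rightarrow> nat \<Rightarrow> nat \<Rightarrow> 'k) set) = card K" by (rule card_image[OF inj])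
  qed
qed

lemma finite_independent_subset_span:
  fixes W B :: "('x \<Rightarrow> nat \<Rightarrow> nat \<Rightarrow> 'k::field) set"
  assumes "finite W" "fscale.independent B" "B \<subseteq> fscale.span W"
  shows "finite B"
  using fscale.independent_span_bound[OF assms] by simp

text \<open>The dimension is the \<open>card\<close> of a basis, hence 0 for an infinite one. The
  finite spanning set \<open>W\<close> rules this out, here and in \<open>kdim_eq_0D\<close>; in
  \<open>kdim_eq_1D\<close> the value 1 already forces a finite basis.\<close>

lemma kdim_mono:
  fixes S T :: "('x \<Rightarrow> nat \<Rightarrow> nat \<Rightarrow> 'k::field) set"
  assumes "finite W" "T \<subseteq> fscale.span W" "S \<subseteq> T"
  shows "kdim S \<le> kdim T"
proof -
  obtain B where B: "B \<subseteq> T" "fscale.independent B" "T \<subseteq> fscale.span B" "card B = fscale.dim T"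
    using fscale.basis_exists by blast
  have "finite B" using finite_independent_subset_span[OF assms(1) B(2)] B(1) assms(2) by blast
  then have "fscale.dim S \<le> card B"
    using B(3) assms(3) by (intro fscale.dim_le_card) auto
  then show ?thesis using B(4) by (simp add: kdim_def)
qed

lemma kdim_eq_0D:
  fixes S :: "('x \<Rightarrow> nat \<Rightarrow> nat \<Rightarrow> 'k::field) set"
  assumes "finite W" "S \<subseteq> fscale.span W" "kdim S = 0" "h \<in> S"
  shows "h = 0"
proof -
  obtain B where B: "B \<subseteq> S" "fscale.independent B" "S \<subseteq> fscale.span B" "card B = fscale.dim S"
    using fscale.basis_exists by blast
  have "finite B" using finite_independent_subset_span[OF assms(1) B(2)] B(1) assms(2) by blast
  then have "B = {}" using B(4) assms(3) by (simp add: kdim_def)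
  then show ?thesis using B(3) assms(4) by auto
qed

lemma kdim_eq_1D:
  fixes S :: "('x \<Rightarrow> nat \<Rightarrow> nat \<Rightarrow> 'k::field) set"
  assumes "kdim S = 1" "g \<in> S" "g \<noteq> 0" "h \<in> S"
  shows "\<exists>c. h = fscale c g"
proof -
  obtain B where B: "S \<subseteq> fscale.span B" "card B = fscale.dim S"
    using fscale.basis_exists by blast
  then obtain b where "B = {b}" using assms(1) by (auto simp: kdim_def card_1_singleton_iff)
  then have "S \<subseteq> range (\<lambda>k. fscale k b)" using B(1) by (simp add: fscale.span_singleton)
  then obtain x y where "g = fscale x b" "h = fscale y b" using assms(2,4) by blast
  moreover from this assms(3) have "x \<noteq> 0" by auto
  ultimately have "h = fscale (y / x) g" by (simp add: fscale.scale_scale)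
  then show ?thesis ..
qed

section \<open>Representations with radical square zero\<close>

lemma supportedD: "supported r c A \<Longrightarrow> r \<le> i \<or> c \<le> j \<Longrightarrow> A i j = 0"
  by (auto simp: supported_def)

lemma supported_zero [simp]: "supported r c (\<lambda>i j. 0)"
  by (simp add: supported_def)

lemma mmul_zero [simp]: "mmul m (\<lambda>i j. 0) B = (\<lambda>i j. 0)" "mmul m A (\<lambda>i j. 0) = (\<lambda>i j. 0)"
  by (simp_all add: mmul_def)

lemma mmul_scalar_left:
  assumes "supported r m A"
  shows "mmul m A (\<lambda>i j. if i = j \<and> i < m then k else 0) = (\<lambda>i j. A i j * k)"
proof (intro ext)
  fix i j
  have "mmul m A (\<lambda>i j. if i = j \<and> i < m then k else 0) i j = (\<Sum>l<m. if l = j then A i l * k else 0)"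
    unfolding mmul_def by (intro sum.cong) auto
  then show "mmul m A (\<lambda>i j. if i = j \<and> i < m then k else 0) i j = A i j * k"
    using assms by (auto simp: supported_def not_less)
qed

lemma mmul_scalar_right:
  assumes "supported m c A"
  shows "mmul m (\<lambda>i j. if i = j \<and> i < m then k else 0) A = (\<lambda>i j. k * A i j)"
proof (intro ext)
  fix i j
  have "mmul m (\<lambda>i j. if i = j \<and> i < m then k else 0) A i j = (\<Sum>l<m. if l = i then k * A l j else 0)"
    unfolding mmul_def by (intro sum.cong) auto
  then show "mmul m (\<lambda>i j. if i = j \<and> i < m then k else 0) A i j = k * A i j"
    using assms by (auto simp: supported_def not_less)
qed

lemma scalar_rank_one_imp_dim_le_1:
  fixes x y :: "nat \<Rightarrow> 'k::field"
  assumes "\<And>i j. i < d \<Longrightarrow> j < d \<Longrightarrow> x i * y j = (if i = j then k else 0)" and "k \<noteq> 0"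
  shows "d \<le> 1"
proof (rule ccontr)
  assume "\<not> d \<le> 1"
  then have "x 0 * y 0 = k" "x 1 * y 1 = k" "x 0 * y 1 = 0"
    using assms(1)[of 0 0] assms(1)[of 1 1] assms(1)[of 0 1] by simp_all
  then show False using \<open>k \<noteq> 0\<close> by auto
qed

locale quiver =
  fixes V :: "nat set" and Ar :: "'a set" and s t :: "'a \<Rightarrow> nat"
  assumes finite_V: "finite V"
    and finite_Ar: "finite Ar"
    and s_in_V: "a \<in> Ar \<Longrightarrow> s a \<in> V"
    and t_in_V: "a \<in> Ar \<Longrightarrow> t a \<in> V"
begin

lemma vfam_subset_span:
  "\<exists>W. finite W \<and> vfam V M N \<subseteq> fscale.span W"
proof (intro exI conjI)
  let ?K = "\<Union>v\<in>V. {v} \<times> {..<fst N v} \<times> {..<fst M v}"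
  show "finite (funit ` ?K)" using finite_V by simp
  show "vfam V M N \<subseteq> fscale.span (funit ` ?K)"
    by (rule fsupp_subset_span) (use finite_V in \<open>auto simp: vfam_def supported_def not_less, metis+\<close>)
qed

lemma afam_subset_span:
  "\<exists>W. finite W \<and> afam Ar s t M N \<subseteq> fscale.span W"
proof (intro exI conjI)
  let ?K = "\<Union>a\<in>Ar. {a} \<times> {..<fst N (t a)} \<times> {..<fst M (s a)}"
  show "finite (funit ` ?K)" using finite_Ar by simp
  show "afam Ar s t M N \<subseteq> fscale.span (funit ` ?K)"
    by (rule fsupp_subset_span) (use finite_Ar in \<open>auto simp: afam_def supported_def not_less, metis+\<close>)
qed

lemma Hom_eq_zero:
  assumes "dimHom V Ar s t M N = 0" "h \<in> Hom_rep V Ar s t M N"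
  shows "h v i j = 0"
proof -
  obtain W where "finite W" "vfam V M N \<subseteq> fscale.span W" using vfam_subset_span by blast
  then have "h = 0"
    using assms by (intro kdim_eq_0D[of W "Hom_rep V Ar s t M N"]) (auto simp: Hom_rep_def dimHom_def)
  then show ?thesis by simp
qed

lemma rep_supported:
  "is_rep V Ar s t M \<Longrightarrow> a \<in> Ar \<Longrightarrow> supported (fst M (t a)) (fst M (s a)) (snd M a)"
  by (simp add: is_rep_def)

lemma rep_outside: "is_rep V Ar s t M \<Longrightarrow> a \<notin> Ar \<Longrightarrow> snd M a = (\<lambda>i j. 0)"
  by (simp add: is_rep_def)

lemma rep_comp_zero:
  assumes "is_rep V Ar s t M" "a \<in> Ar" "b \<in> Ar" "t a = v" "s b = v"
  shows "(\<Sum>l<fst M v. snd M b i l * snd M a l j) = 0"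
proof -
  have "t a = s b \<longrightarrow> mmul (fst M (s b)) (snd M b) (snd M a) = (\<lambda>i j. 0)"
    using assms(1-3) by (simp add: is_rep_def)
  then show ?thesis using assms(4,5) by (simp add: mmul_def fun_eq_iff)
qed

lemma id_in_Hom:
  assumes "is_rep V Ar s t M"
  shows "(\<lambda>v i j. if i = j \<and> i < fst M v then 1 else 0) \<in> Hom_rep V Ar s t M M"
proof -
  have "(\<lambda>v i j. if i = j \<and> i < fst M v then 1 else 0) \<in> vfam V M M"
    using assms by (auto simp: vfam_def is_rep_def supported_def fun_eq_iff)
  moreover have "mmul (fst M (s a)) (snd M a) (\<lambda>i j. if i = j \<and> i < fst M (s a) then 1 else 0)
      = mmul (fst M (t a)) (\<lambda>i j. if i = j \<and> i < fst M (t a) then 1 else 0) (snd M a)"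
    if "a \<in> Ar" for a
    using rep_supported[OF assms that] by (simp add: mmul_scalar_left mmul_scalar_right)
  ultimately show ?thesis by (simp add: Hom_rep_def)
qed

lemma brick_End_scalar:
  assumes "is_brick V Ar s t M" "h \<in> Hom_rep V Ar s t M M"
  obtains k where "\<And>v i j. h v i j = (if i = j \<and> i < fst M v then k else 0)"
proof -
  let ?I = "\<lambda>v i j. if i = j \<and> i < fst M v then 1 else (0::'b)"
  obtain v where "fst M v > 0" using assms(1) by (auto simp: is_brick_def nonzero_rep_def)
  then have "?I v 0 0 \<noteq> (0 :: nat \<Rightarrow> nat \<Rightarrow> nat \<Rightarrow> 'b) v 0 0" by simp
  then have "?I \<noteq> 0" by (rule contrapos_nn) (rule arg_cong[of _ _ "\<lambda>f. f v 0 0"])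
  moreover have "?I \<in> Hom_rep V Ar s t M M" "kdim (Hom_rep V Ar s t M M) = 1"
    using assms(1) id_in_Hom[of M] by (simp_all add: is_brick_def dimHom_def)
  ultimately obtain k where k: "h = fscale k ?I"
    using kdim_eq_1D[of "Hom_rep V Ar s t M M" ?I h] assms(2) by blast
  show ?thesis by (rule that[of k]) (simp add: k fscale_def)
qed

section \<open>Top and socle at a vertex\<close>

definition is_soc :: "('a, 'k::field) rep \<Rightarrow> nat \<Rightarrow> (nat \<Rightarrow> 'k) \<Rightarrow> bool" where
  "is_soc M v w \<longleftrightarrow> (\<forall>i\<ge>fst M v. w i = 0) \<and>
     (\<forall>b\<in>Ar. s b = v \<longrightarrow> (\<forall>i. (\<Sum>l<fst M v. snd M b i l * w l) = 0))"

text \<open>A functional that kills the images of all incoming arrows, that is, an element of the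
  dual of the top. As in \<open>is_soc\<close>, entries beyond the dimension are 0, so that
  vanishing is equality with the zero function.\<close>

definition is_top :: "('a, 'k::field) rep \<Rightarrow> nat \<Rightarrow> (nat \<Rightarrow> 'k) \<Rightarrow> bool" where
  "is_top M v \<alpha> \<longleftrightarrow> (\<forall>j\<ge>fst M v. \<alpha> j = 0) \<and>
     (\<forall>a\<in>Ar. t a = v \<longrightarrow> (\<forall>j. (\<Sum>l<fst M v. \<alpha> l * snd M a l j) = 0))"

text \<open>This is the composite of \<open>M\<close> onto a line of its top at \<open>v\<close>
  with the inclusion of a line of the socle of \<open>N\<close>; both sides of every commutation
  square are 0.\<close>

lemma rank_one_in_Hom:
  assumes "is_top M v \<alpha>" "is_soc N v w" "v \<in> V"
  shows "(\<lambda>u i j. if u = v then w i * \<alpha> j else 0) \<in> Hom_rep V Ar s t M N" (is "?h \<in> _")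
proof -
  have "?h \<in> vfam V M N"
    using assms by (auto simp: vfam_def supported_def is_soc_def is_top_def fun_eq_iff)
  moreover have "mmul (fst N (s a)) (snd N a) (?h (s a)) = (\<lambda>i j. 0)" if "a \<in> Ar" for a
  proof (cases "s a = v")
    case True
    then show ?thesis using that assms(2)
      by (simp add: mmul_def is_soc_def mult.assoc[symmetric] sum_distrib_right[symmetric])
  qed (simp add: mmul_def)
  moreover have "mmul (fst M (t a)) (?h (t a)) (snd M a) = (\<lambda>i j. 0)" if "a \<in> Ar" for a
  proof (cases "t a = v")
    case True
    then show ?thesis using that assms(1)
      by (simp add: mmul_def is_top_def mult.assoc sum_distrib_left[symmetric])
  qed (simp add: mmul_def)
  ultimately show ?thesis by (simp add: Hom_rep_def)
qed

text \<open>Composites of two arrows vanish, so the columns of an arrow into \<open>v\<close> are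
  socle vectors at \<open>v\<close>. Dually, in \<open>arrow_zero_of_top_zero\<close> the rows of an
  arrow out of \<open>v\<close> are top functionals.\<close>

lemma arrow_zero_of_soc_zero:
  assumes M: "is_rep V Ar s t M" and soc: "\<And>w. is_soc M v w \<Longrightarrow> w = (\<lambda>i. 0)"
    and a: "a \<in> Ar" "t a = v"
  shows "snd M a = (\<lambda>i j. 0)"
proof (intro ext)
  fix i j
  have "is_soc M v (\<lambda>i. snd M a i j)"
    using rep_comp_zero[OF M a(1) _ a(2)] rep_supported[OF M a(1)] a(2)
    by (simp add: is_soc_def supported_def)
  from soc[OF this] show "snd M a i j = 0" by (rule fun_cong)
qed

lemma arrow_zero_of_top_zero:
  assumes M: "is_rep V Ar s t M" and top: "\<And>\<alpha>. is_top M v \<alpha> \<Longrightarrow> \<alpha> = (\<lambda>i. 0)"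
    and b: "b \<in> Ar" "s b = v"
  shows "snd M b = (\<lambda>i j. 0)"
proof (intro ext)
  fix i j
  have "is_top M v (snd M b i)"
    using rep_comp_zero[OF M _ b(1) _ b(2)] rep_supported[OF M b(1)] b(2)
    by (simp add: is_top_def supported_def)
  from top[OF this] show "snd M b i j = 0" by (rule fun_cong)
qed

lemma top_zero_imp_incoming_nonzero:
  assumes M: "is_rep V Ar s t M" and top: "\<And>\<alpha>. is_top M v \<alpha> \<Longrightarrow> \<alpha> = (\<lambda>i. 0)" and d: "fst M v > 0"
  shows "\<exists>a\<in>Ar. t a = v \<and> snd M a \<noteq> (\<lambda>i j. 0)"
proof (rule ccontr)
  assume "\<not> ?thesis"
  then have "is_top M v (\<lambda>i. if i = 0 then 1 else 0)" using d by (auto simp: is_top_def)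
  from fun_cong[OF top[OF this], of 0] show False by simp
qed

text \<open>The rank-one endomorphism concentrated at \<open>v\<close> must be a nonzero scalar,
  which leaves no room for another vertex or for dimension 2 at \<open>v\<close>.\<close>

lemma brick_top_soc_imp_simple:
  assumes M: "is_brick V Ar s t M" and v: "v \<in> V"
    and top: "is_top M v \<alpha>" "\<alpha> \<noteq> (\<lambda>i. 0)" and soc: "is_soc M v w" "w \<noteq> (\<lambda>i. 0)"
  shows "fst M = (\<lambda>u. if u = v then 1 else 0) \<and> (\<forall>a. snd M a = (\<lambda>i j. 0))"
proof -
  have rep: "is_rep V Ar s t M" using M by (simp add: is_brick_def)
  let ?h = "\<lambda>u i j. if u = v then w i * \<alpha> j else 0"
  obtain k where k: "\<And>u i j. ?h u i j = (if i = j \<and> i < fst M u then k else 0)"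
    using brick_End_scalar[OF M rank_one_in_Hom[OF top(1) soc(1) v]] by blast
  obtain i j where ij: "w i \<noteq> 0" "\<alpha> j \<noteq> 0" using top(2) soc(2) by (auto simp: fun_eq_iff)
  then have "k \<noteq> 0" and dv: "fst M v > 0" using k[of v i j] by (auto split: if_splits)
  have "fst M v \<le> 1"
    by (rule scalar_rank_one_imp_dim_le_1[OF _ \<open>k \<noteq> 0\<close>, of _ w \<alpha>]) (use k[of v] in auto)
  moreover have "fst M u = 0" if "u \<noteq> v" for u
    using k[of u 0 0] that \<open>k \<noteq> 0\<close> by (auto split: if_splits)
  ultimately have d: "fst M = (\<lambda>u. if u = v then 1 else 0)" using dv by (auto simp: fun_eq_iff)
  have "snd M a = (\<lambda>i j. 0)" for a
  proof (cases "a \<in> Ar")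
    case True
    then have sup: "supported (fst M (t a)) (fst M (s a)) (snd M a)" using rep by (auto simp: is_rep_def)
    show ?thesis
    proof (cases "t a = v")
      case False
      then show ?thesis using sup d by (auto simp: supported_def)
    next
      \<comment> \<open>Dimensions alone do not exclude loops at \<open>v\<close>. The functional
        \<open>\<alpha>\<close> kills their image and is nonzero at the only index 0.\<close>
      case ta: True
      have "\<not> fst M v \<le> j" using top(1) ij by (auto simp: is_top_def)
      then have "j = 0" using d by simp
      then have "snd M a 0 j' = 0" for j' using top(1) True ta ij d by (auto simp: is_top_def)
      moreover have "snd M a i' j' = 0" if "i' \<noteq> 0" for i' j'
        using sup ta d that by (simp add: supported_def)
      ultimately have "snd M a i' j' = 0" for i' j' by (cases "i' = 0") auto
      then show ?thesis by (simp add: fun_eq_iff)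
    qed
  qed (use rep in \<open>simp add: is_rep_def\<close>)
  then show ?thesis using d by simp
qed

text \<open>\<open>dimExt1\<close> is a truncated difference, so it suffices to compare dimensions.
  That coboundaries lie in \<open>afam\<close> provides the finite spanning set for
  \<open>kdim_mono\<close>.\<close>

lemma dimExt1_eq_0I:
  assumes "Z1_rep Ar s t M N \<subseteq> B1_rep V Ar s t M N" "is_rep V Ar s t M" "is_rep V Ar s t N"
  shows "dimExt1 V Ar s t M N = 0"
proof -
  obtain W where W: "finite W" "afam Ar s t M N \<subseteq> fscale.span W" using afam_subset_span by blast
  have "B1_rep V Ar s t M N \<subseteq> afam Ar s t M N"
  proof (clarsimp simp: B1_rep_def afam_def)
    fix h a assume h: "h \<in> vfam V M N" and a: "a \<in> Ar"
    then have "supported (fst N (s a)) (fst M (s a)) (h (s a))"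
        "supported (fst N (t a)) (fst M (t a)) (h (t a))"
      using s_in_V t_in_V by (simp_all add: vfam_def)
    then show "supported (fst N (t a)) (fst M (s a))
        (\<lambda>i j. mmul (fst N (s a)) (snd N a) (h (s a)) i j - mmul (fst M (t a)) (h (t a)) (snd M a) i j)"
      using rep_supported[OF assms(2) a] rep_supported[OF assms(3) a]
      by (auto simp: supported_def mmul_def)
  qed
  then have "kdim (Z1_rep Ar s t M N) \<le> kdim (B1_rep V Ar s t M N)"
    using W assms(1) by (intro kdim_mono) auto
  then show ?thesis by (simp add: dimExt1_def)
qed

end

section \<open>Bricks over E(n)\<close>

definition E_parent :: "nat \<Rightarrow> nat" where
  "E_parent v = E_src (v, 0)"

text \<open>Distance from the root in the tree 1 -> 3 -> 4 with branches 4 -> 2 and 4 -> 5 -> 6 ->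
  ...; vertices 2 and 5 share depth 3.\<close>

definition E_depth :: "nat \<Rightarrow> nat" where
  "E_depth v = (if v = 1 then 0 else if v = 2 then 3 else v - 2)"

lemma E_depth_parent: "2 \<le> v \<Longrightarrow> E_depth v = Suc (E_depth (E_parent v))"
  by (auto simp: E_depth_def E_parent_def E_src_def)

lemma E_parent_neq: "2 \<le> v \<Longrightarrow> E_parent v \<noteq> v"
  using E_depth_parent[of v] by auto

lemma E_child_cases:
  assumes "2 \<le> c" "E_parent c = p"
  shows "c = 2 \<or> c = (if p = 1 then 3 else if p = 3 then 4 else Suc p)"
  using assms by (auto simp: E_parent_def E_src_def split: if_split_asm)

text \<open>Apart from 2, a child is determined by \<open>p\<close>, so two of any three children
  coincide.\<close>

lemma E_at_most_two_children:
  assumes "2 \<le> a" "2 \<le> b" "2 \<le> c" "E_parent a = p" "E_parent b = p" "E_parent c = p"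
  shows "a = b \<or> b = c \<or> a = c"
  using E_child_cases[OF assms(1,4)] E_child_cases[OF assms(2,5)] E_child_cases[OF assms(3,6)]
  by metis

lemma E_src_arrow [simp]: "E_src (v, 0) = E_parent v" "E_src (v, Suc k) = v"
  and E_tgt_arrow [simp]: "E_tgt (v, k) = v"
  by (simp_all add: E_parent_def E_src_def E_tgt_def)

locale E_quiver =
  fixes n :: nat and N :: "nat \<Rightarrow> nat"
  assumes n_ge_4: "4 \<le> n"
begin

abbreviation "V \<equiv> E_verts n"
abbreviation "Ar \<equiv> E_arrows n N"

lemma arrow_iff [simp]:
  "(v, 0) \<in> Ar \<longleftrightarrow> 2 \<le> v \<and> v \<le> n"
  "(v, Suc k) \<in> Ar \<longleftrightarrow> 1 \<le> v \<and> v \<le> n \<and> k < N v"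
  by (auto simp: E_arrows_def)

lemma E_parent_in_V: "2 \<le> v \<Longrightarrow> v \<le> n \<Longrightarrow> E_parent v \<in> V"
  using n_ge_4 by (auto simp: E_parent_def E_src_def E_verts_def)

lemma arrow_cases [consumes 1, case_names edge loop]:
  assumes "a \<in> Ar"
  obtains v where "a = (v, 0)" "2 \<le> v" "v \<le> n" | v k where "a = (v, Suc k)" "1 \<le> v" "v \<le> n" "k < N v"
proof (cases a)
  case (Pair v k)
  then show ?thesis using assms that by (cases k) auto
qed

sublocale quiver V Ar E_src E_tgt
proof
  show "finite V" by (simp add: E_verts_def)
  have "Ar \<subseteq> (\<Union>v\<in>{1..n}. {v} \<times> {..N v})" by (auto simp: E_arrows_def)
  then show "finite Ar" by (rule finite_subset) simp
  show "E_src a \<in> V" if "a \<in> Ar" for a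
    using that by (cases rule: arrow_cases) (auto simp: E_parent_in_V, simp add: E_verts_def)
  show "E_tgt a \<in> V" if "a \<in> Ar" for a
    using that by (cases rule: arrow_cases) (auto simp: E_verts_def)
qed

text \<open>\<^term>\<open>thin M p C\<close> is the normal form of a brick: the simple module at p if C is empty, and
  otherwise the module with one-dimensional top at p and one-dimensional socle at each child of p in C.\<close>
definition thin :: "(nat \<times> nat, 'k::field) rep \<Rightarrow> nat \<Rightarrow> nat set \<Rightarrow> bool" where
  "thin M p C \<longleftrightarrow> is_rep V Ar E_src E_tgt M \<and> p \<in> V \<and>
     C \<subseteq> {c. 2 \<le> c \<and> c \<le> n \<and> E_parent c = p} \<and>
     fst M = (\<lambda>v. if v \<in> insert p C then 1 else 0) \<and>
     (\<forall>a. snd M a 0 0 \<noteq> 0 \<longleftrightarrow> (\<exists>c\<in>C. a = (c, 0)))"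

text \<open>Each restriction on \<open>M\<close> is read off from an explicit endomorphism that
  \<open>brick_End_scalar\<close> forces to be a scalar. No basis is changed: \<open>thin\<close>
  asks only that the entries on the edges into \<open>C\<close> be nonzero.\<close>

lemma brick_thin:
  fixes M :: "(nat \<times> nat, 'k::field) rep"
  assumes M: "is_brick V Ar E_src E_tgt M"
  obtains p C where "thin M p C"
proof (cases "\<exists>v\<in>V. \<exists>\<alpha> w. is_top M v \<alpha> \<and> \<alpha> \<noteq> (\<lambda>i. 0) \<and> is_soc M v w \<and> w \<noteq> (\<lambda>i. 0)")
  case True
  then obtain v where "v \<in> V" "fst M = (\<lambda>u. if u = v then 1 else 0)" "\<forall>a. snd M a = (\<lambda>i j. 0)"
    using brick_top_soc_imp_simple[OF M] by blast
  then have "thin M v {}" using M by (simp add: thin_def is_brick_def)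
  then show ?thesis by (rule that)
next
  case False
  have rep: "is_rep V Ar E_src E_tgt M" using M by (simp add: is_brick_def)
  define soc0 where "soc0 v \<longleftrightarrow> (\<forall>w. is_soc M v w \<longrightarrow> w = (\<lambda>i. 0))" for v
  define top0 where "top0 v \<longleftrightarrow> (\<forall>\<alpha>. is_top M v \<alpha> \<longrightarrow> \<alpha> = (\<lambda>i. 0))" for v
  have dich: "soc0 v \<or> top0 v" if "v \<in> V" for v
    using False that unfolding soc0_def top0_def by blast
  have in0: "snd M a = (\<lambda>i j. 0)" if "soc0 (E_tgt a)" "a \<in> Ar" for a
    using arrow_zero_of_soc_zero[OF rep _ that(2) refl] that(1) unfolding soc0_def by blast
  have out0: "snd M a = (\<lambda>i j. 0)" if "top0 (E_src a)" "a \<in> Ar" for a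
    using arrow_zero_of_top_zero[OF rep _ that(2) refl] that(1) unfolding top0_def by blast
  have top0_in: "\<exists>a\<in>Ar. E_tgt a = v \<and> snd M a \<noteq> (\<lambda>i j. 0)" if "top0 v" "fst M v > 0" for v
    using top_zero_imp_incoming_nonzero[OF rep _ that(2)] that(1) unfolding top0_def by blast
  have nz_Ar: "a \<in> Ar" if "snd M a \<noteq> (\<lambda>i j. 0)" for a
    using rep that unfolding is_rep_def by blast
  have nz_dims: "fst M (E_src a) > 0 \<and> fst M (E_tgt a) > 0" if "snd M a \<noteq> (\<lambda>i j. 0)" for a
  proof (rule ccontr)
    assume "\<not> ?thesis"
    then have "snd M a = (\<lambda>i j. 0)"
      using rep_supported[OF rep nz_Ar[OF that]] by (auto simp: supported_def fun_eq_iff)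
    then show False using that by simp
  qed
  have nz_edge: "\<exists>v. a = (v, 0) \<and> 2 \<le> v \<and> v \<le> n" if "snd M a \<noteq> (\<lambda>i j. 0)" for a
    using nz_Ar[OF that]
  proof (cases rule: arrow_cases)
    \<comment> \<open>A loop both enters and leaves \<open>v\<close>, so either alternative of
      \<open>dich\<close> kills it.\<close>
    case (loop v k)
    then have "v \<in> V" by (simp add: E_verts_def)
    then show ?thesis using dich[of v] in0[of a] out0[of a] that nz_Ar[OF that] loop by auto
  qed auto
  \<comment> \<open>If a vertex of the support has nonzero socle, its top is zero and some nonzero
    arrow enters it; the source of that arrow has nonzero top, hence zero socle.\<close>
  obtain p where p: "p \<in> V" "fst M p > 0" "soc0 p"
  proof -
    obtain v where v: "v \<in> V" "fst M v > 0" using M by (auto simp: is_brick_def nonzero_rep_def)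
    show ?thesis
    proof (cases "soc0 v")
      case False
      then obtain a where a: "E_tgt a = v" "snd M a \<noteq> (\<lambda>i j. 0)"
        using dich v top0_in by blast
      then have "\<not> top0 (E_src a)" using out0 nz_Ar by blast
      moreover have "E_src a \<in> V" using a s_in_V nz_Ar by blast
      ultimately show ?thesis using that nz_dims[OF a(2)] dich by blast
    qed (use v that in blast)
  qed
  \<comment> \<open>Projecting to the vertices in S commutes with all arrows, so M is supported in S.\<close>
  define S where "S = insert p {c. 2 \<le> c \<and> c \<le> n \<and> E_parent c = p \<and> top0 c}"
  have edge_S: "(v \<in> S \<longleftrightarrow> E_parent v \<in> S) \<and> (v \<in> S \<longrightarrow> E_parent v = p)"
    if nz: "snd M (v, 0) \<noteq> (\<lambda>i j. 0)" and v: "2 \<le> v" "v \<le> n" for v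
  proof -
    have "\<not> top0 (E_parent v)" "\<not> soc0 v" using nz in0[of "(v, 0)"] out0[of "(v, 0)"] v by auto
    moreover have "v \<in> V" using v by (simp add: E_verts_def)
    ultimately show ?thesis using dich[of v] p(3) v by (auto simp: S_def)
  qed
  have outside_S: "fst M v = 0" if "v \<notin> S" for v
  proof -
    let ?h = "\<lambda>v i j. if i = j \<and> i < fst M v then (if v \<in> S then 1 else 0 :: 'k) else 0"
    have "?h \<in> vfam V M M" using rep by (auto simp: vfam_def supported_def is_rep_def fun_eq_iff)
    moreover have "mmul (fst M (E_src a)) (snd M a) (?h (E_src a))
        = mmul (fst M (E_tgt a)) (?h (E_tgt a)) (snd M a)" if a: "a \<in> Ar" for a
    proof (cases "snd M a = (\<lambda>i j. 0)")
      case False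
      then obtain u where u: "a = (u, 0)" "2 \<le> u" "u \<le> n" using nz_edge by blast
      then have "E_tgt a \<in> S \<longleftrightarrow> E_src a \<in> S" using edge_S[of u] False by simp
      then show ?thesis
        unfolding mmul_scalar_left[OF rep_supported[OF rep a]] mmul_scalar_right[OF rep_supported[OF rep a]]
        by simp
    qed simp
    ultimately have "?h \<in> Hom_rep V Ar E_src E_tgt M M" by (simp add: Hom_rep_def)
    then obtain k where k: "\<And>u x y. ?h u x y = (if x = y \<and> x < fst M u then k else 0)"
      by (rule brick_End_scalar[OF M]) blast
    have "k = 1" using k[of 0 0 p] p(2) by (simp add: S_def)
    then show ?thesis using k[of 0 0 v] that by (auto split: if_splits)
  qed
  define C where "C = {c. 2 \<le> c \<and> c \<le> n \<and> E_parent c = p \<and> fst M c > 0}"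
  have C_top0: "top0 c" and C_neq: "c \<noteq> p" if "c \<in> C" for c
  proof -
    show "c \<noteq> p" using that E_parent_neq[of c] by (auto simp: C_def)
    then show "top0 c" using outside_S[of c] that by (auto simp: S_def C_def)
  qed
  have nz_C: "\<exists>c\<in>C. a = (c, 0)" if nz: "snd M a \<noteq> (\<lambda>i j. 0)" for a
  proof -
    obtain v where v: "a = (v, 0)" "2 \<le> v" "v \<le> n" using nz_edge[OF nz] by blast
    moreover have "fst M v > 0" using nz_dims[OF nz] v by simp
    moreover from this have "v \<in> S" using outside_S by force
    ultimately show ?thesis using edge_S[of v] nz by (auto simp: C_def)
  qed
  have C_nz: "snd M (c, 0) \<noteq> (\<lambda>i j. 0)" if c: "c \<in> C" for c
  proof -
    have "fst M c > 0" using c by (simp add: C_def)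
    then obtain a where "E_tgt a = c" "snd M a \<noteq> (\<lambda>i j. 0)"
      using top0_in[OF C_top0[OF c]] by blast
    then show ?thesis using nz_C[of a] by auto
  qed
  have HomI: "h \<in> Hom_rep V Ar E_src E_tgt M M"
    if "h \<in> vfam V M M"
      and "\<And>c. c \<in> C \<Longrightarrow> mmul (fst M p) (snd M (c, 0)) (h p) = mmul (fst M c) (h c) (snd M (c, 0))" for h
  proof -
    have "mmul (fst M (E_src a)) (snd M a) (h (E_src a)) = mmul (fst M (E_tgt a)) (h (E_tgt a)) (snd M a)" for a
    proof (cases "snd M a = (\<lambda>i j. 0)")
      case False
      then obtain c where "c \<in> C" "a = (c, 0)" using nz_C by blast
      then show ?thesis using that(2) by (simp add: C_def)
    qed simp
    then show ?thesis using that(1) by (simp add: Hom_rep_def)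
  qed
  have C_sup: "supported (fst M c) (fst M p) (snd M (c, 0))" if "c \<in> C" for c
    using rep_supported[OF rep, of "(c, 0)"] that by (auto simp: C_def)
  have C_V: "c \<in> V" if "c \<in> C" for c
    using that by (auto simp: C_def E_verts_def)
  \<comment> \<open>If the map p \<rightarrow> c kills w, then some map p \<rightarrow> c' with c' \<noteq> c does not, and composing a row of that map
    with w gives a non-scalar endomorphism. This needs that p has at most two children.\<close>
  have inj: "w = (\<lambda>i. 0)"
    if c: "c \<in> C" and w0: "\<And>i. i \<ge> fst M p \<Longrightarrow> w i = 0"
      and ker: "\<And>i. (\<Sum>l<fst M p. snd M (c, 0) i l * w l) = 0" for c w
  proof (rule ccontr)
    assume "w \<noteq> (\<lambda>i. 0)"
    then have "\<not> is_soc M p w" using p(3) by (auto simp: soc0_def)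
    then obtain b i where b: "b \<in> Ar" "E_src b = p" "(\<Sum>l<fst M p. snd M b i l * w l) \<noteq> 0"
      using w0 by (auto simp: is_soc_def)
    then have "snd M b \<noteq> (\<lambda>i j. 0)" by auto
    then obtain c' where c': "c' \<in> C" "b = (c', 0)" using nz_C by blast
    define x where "x = (\<lambda>i'. \<Sum>l<fst M p. snd M (c', 0) i' l * w l)"
    have xi: "x i \<noteq> 0" using b c' by (simp add: x_def)
    have x0: "x i' = 0" if "fst M c' \<le> i'" for i'
      using C_sup[OF c'(1)] that by (simp add: x_def supported_def)
    have i: "i < fst M c'" using xi x0 not_less by blast
    have "c' \<noteq> c" using xi ker by (auto simp: x_def)
    \<comment> \<open>At \<open>p\<close> this is \<open>w\<close> times row \<open>i\<close> of the
      map to \<open>c'\<close>; at \<open>c'\<close> it is \<open>x\<close> in column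
      \<open>i\<close>. As \<open>x\<close> is the image of \<open>w\<close>, both sides of the
      square at \<open>c'\<close> are \<open>x\<close> times row \<open>i\<close>.\<close>
    let ?h = "\<lambda>u i' j. if u = p then w i' * snd M (c', 0) i j else if u = c' \<and> j = i then x i' else 0"
    have "?h \<in> Hom_rep V Ar E_src E_tgt M M"
    proof (rule HomI)
      show "?h \<in> vfam V M M"
        using w0 x0 i p(1) C_V[OF c'(1)] C_sup[OF c'(1)]
        by (auto simp: vfam_def supported_def fun_eq_iff)
      fix c'' assume c'': "c'' \<in> C"
      have left: "mmul (fst M p) (snd M (c'', 0)) (?h p)
          = (\<lambda>i' j. (\<Sum>l<fst M p. snd M (c'', 0) i' l * w l) * snd M (c', 0) i j)"
        by (simp add: mmul_def mult.assoc sum_distrib_right)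
      show "mmul (fst M p) (snd M (c'', 0)) (?h p) = mmul (fst M c'') (?h c'') (snd M (c'', 0))"
      proof (cases "c'' = c'")
        case True
        have "(\<Sum>l<fst M c'. (if l = i then x i' else 0) * snd M (c', 0) l j) = x i' * snd M (c', 0) i j" for i' j
          using i by (simp add: if_distrib[of "\<lambda>y. y * _"] cong: if_cong)
        then show ?thesis unfolding left using True C_neq[OF c'(1)] by (simp add: mmul_def x_def)
      next
        case False
        then have "c'' = c"
          using E_at_most_two_children[of c'' c' c p] c c'(1) c'' \<open>c' \<noteq> c\<close> by (auto simp: C_def)
        then show ?thesis unfolding left using ker False C_neq[OF c] by simp
      qed
    qed
    then obtain k where k: "\<And>u x y. ?h u x y = (if x = y \<and> x < fst M u then k else 0)"
      by (rule brick_End_scalar[OF M]) blast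
    \<comment> \<open>The component at \<open>c\<close> is 0 on a nonzero space, whereas the
      diagonal entry \<open>x i\<close> at \<open>c'\<close> is not 0.\<close>
    have "k = 0" using k[of c 0 0] c C_neq[OF c] \<open>c' \<noteq> c\<close> by (simp add: C_def)
    then show False using k[of c' i i] xi C_neq[OF c'(1)] by (simp split: if_splits)
  qed
  \<comment> \<open>Injectivity lets the projection to the first basis vector of M p factor through every child, which
    gives an endomorphism of rank one at every vertex.\<close>
  have "\<exists>\<beta>. \<forall>l<fst M p. (if l = 0 then 1 else 0) = (\<Sum>i<fst M c. \<beta> i * snd M (c, 0) i l)" if c: "c \<in> C" for c
  proof (rule kernel_subset_imp_row_combination)
    fix w :: "nat \<Rightarrow> 'k"
    assume w: "\<And>i. i < fst M c \<Longrightarrow> (\<Sum>l<fst M p. snd M (c, 0) i l * w l) = 0"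
    have "(\<Sum>l<fst M p. snd M (c, 0) i l * (if l < fst M p then w l else 0)) = 0" for i
      using w[of i] C_sup[OF c] by (cases "i < fst M c") (simp_all add: supported_def)
    then have "(\<lambda>l. if l < fst M p then w l else 0) = (\<lambda>i. 0)" by (intro inj[OF c]) auto
    then have "w 0 = 0" using p(2) by (metis (mono_tags))
    then show "(\<Sum>l<fst M p. (if l = 0 then 1 else 0) * w l) = 0"
      by (intro sum.neutral) auto
  qed
  then obtain \<beta> where \<beta>: "\<And>c l. c \<in> C \<Longrightarrow> l < fst M p \<Longrightarrow>
      (\<Sum>i<fst M c. \<beta> c i * snd M (c, 0) i l) = (if l = 0 then 1 else 0)"
    by metis
  \<comment> \<open>At a child \<open>u\<close> the component is column 0 of the map from
    \<open>p\<close>, times the row \<open>\<beta> u\<close>. Since \<open>\<beta> u\<close>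
    composed with the map is the coordinate functional 0, the square commutes with the matrix unit
    at \<open>p\<close>.\<close>
  let ?h = "\<lambda>u i j. if u = p then (if i = 0 \<and> j = 0 then 1 else 0)
    else if u \<in> C \<and> j < fst M u then snd M (u, 0) i 0 * \<beta> u j else 0"
  have "?h \<in> Hom_rep V Ar E_src E_tgt M M"
  proof (rule HomI)
    show "?h \<in> vfam V M M"
      using p(1,2) C_V C_sup by (auto simp: vfam_def supported_def fun_eq_iff)
    fix c assume c: "c \<in> C"
    have "mmul (fst M p) (snd M (c, 0)) (?h p) i j = mmul (fst M c) (?h c) (snd M (c, 0)) i j" for i j
    proof -
      have "mmul (fst M p) (snd M (c, 0)) (?h p) i j
          = (\<Sum>l<fst M p. if l = 0 then snd M (c, 0) i 0 * (if j = 0 then 1 else 0) else 0)"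
        unfolding mmul_def by (intro sum.cong) auto
      also have "\<dots> = snd M (c, 0) i 0 * (if j = 0 then 1 else 0)" using p(2) by simp
      also have "\<dots> = snd M (c, 0) i 0 * (\<Sum>l<fst M c. \<beta> c l * snd M (c, 0) l j)"
      proof (cases "j < fst M p")
        case False
        then show ?thesis using p(2) C_sup[OF c] by (simp add: supported_def)
      qed (use \<beta>[OF c] in simp)
      also have "\<dots> = mmul (fst M c) (?h c) (snd M (c, 0)) i j"
        using c C_neq[OF c] by (simp add: mmul_def sum_distrib_left mult.assoc)
      finally show ?thesis .
    qed
    then show "mmul (fst M p) (snd M (c, 0)) (?h p) = mmul (fst M c) (?h c) (snd M (c, 0))"
      by (intro ext)
  qed
  then obtain k where k: "\<And>u x y. ?h u x y = (if x = y \<and> x < fst M u then k else 0)"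
    by (rule brick_End_scalar[OF M]) blast
  have k1: "k = 1" using k[of p 0 0] p(2) by simp
  \<comment> \<open>The entry (1, 1) at \<open>p\<close> is 0, but would be \<open>k = 1\<close> if
    the dimension exceeded 1.\<close>
  have "fst M p \<le> 1" using k[of p 1 1] k1 by (simp split: if_splits)
  then have dp: "fst M p = 1" using p(2) by simp
  have dc: "fst M c = 1" if c: "c \<in> C" for c
  proof -
    have "fst M c \<le> 1"
    proof (rule scalar_rank_one_imp_dim_le_1)
      show "snd M (c, 0) i 0 * \<beta> c j = (if i = j then k else 0)" if "i < fst M c" "j < fst M c" for i j
        using k[of c i j] c C_neq[OF c] that by simp
    qed (simp add: k1)
    then show ?thesis using c by (simp add: C_def)
  qed
  have "fst M v = 0" if "v \<notin> insert p C" for v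
    using outside_S[of v] that by (auto simp: S_def C_def)
  then have d: "fst M = (\<lambda>v. if v \<in> insert p C then 1 else 0)"
    using dp dc by (auto simp: fun_eq_iff)
  have "snd M a 0 0 \<noteq> 0 \<longleftrightarrow> (\<exists>c\<in>C. a = (c, 0))" for a
  proof
    assume "snd M a 0 0 \<noteq> 0"
    then have "snd M a \<noteq> (\<lambda>i j. 0)" by auto
    then show "\<exists>c\<in>C. a = (c, 0)" by (rule nz_C)
  next
    assume "\<exists>c\<in>C. a = (c, 0)"
    then obtain c where c: "c \<in> C" "a = (c, 0)" by blast
    then obtain i j where "snd M a i j \<noteq> 0" using C_nz[of c] by (auto simp: fun_eq_iff)
    moreover from this have "i < 1" "j < 1"
      using C_sup[OF c(1)] c dp dc[OF c(1)] by (auto simp: supported_def simp flip: not_le)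
    ultimately show "snd M a 0 0 \<noteq> 0" by simp
  qed
  moreover have "C \<subseteq> {c. 2 \<le> c \<and> c \<le> n \<and> E_parent c = p}" by (auto simp: C_def)
  ultimately have "thin M p C" using rep p(1) d unfolding thin_def by blast
  then show ?thesis by (rule that)
qed

section \<open>Extensions between bricks\<close>

lemma thin_child:
  "thin M p C \<Longrightarrow> c \<in> C \<Longrightarrow> 2 \<le> c \<and> c \<le> n \<and> E_parent c = p"
  by (auto simp: thin_def)

lemma thin_top_notin: "thin M p C \<Longrightarrow> p \<notin> C"
  using thin_child[of M p C p] E_parent_neq[of p] by auto

lemma thin_rep: "thin M p C \<Longrightarrow> is_rep V Ar E_src E_tgt M"
  by (simp add: thin_def)

lemma thin_dim: "thin M p C \<Longrightarrow> fst M v = (if v \<in> insert p C then 1 else 0)"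
  by (simp add: thin_def)

lemma thin_arrow_iff: "thin M p C \<Longrightarrow> snd M a 0 0 \<noteq> 0 \<longleftrightarrow> (\<exists>c\<in>C. a = (c, 0))"
  unfolding thin_def by blast

lemma thin_arrow_entry:
  assumes M: "thin M p C" and ij: "i \<noteq> 0 \<or> j \<noteq> 0"
  shows "snd M a i j = 0"
proof (cases "a \<in> Ar")
  case True
  have "fst M v \<le> 1" for v using thin_dim[OF M, of v] by simp
  then show ?thesis
    using supportedD[OF rep_supported[OF thin_rep[OF M] True], of i j] ij
    by (metis One_nat_def Suc_leI le_trans not_gr_zero)
qed (use rep_outside[OF thin_rep[OF M]] in simp)

lemma thin_arrow_zero:
  "thin M p C \<Longrightarrow> \<not> (\<exists>c\<in>C. a = (c, 0)) \<Longrightarrow> snd M a i j = 0"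
  using thin_arrow_iff[of M p C a] thin_arrow_entry[of M p C i j a] by (cases "i = 0 \<and> j = 0") auto

lemma mmul_thin:
  "thin M p C \<Longrightarrow> mmul (fst M v) A B i j = (if v \<in> insert p C then A i 0 * B 0 j else 0)"
  by (simp add: thin_dim mmul_def)

lemma thin_is_top: "thin M p C \<Longrightarrow> is_top M p (\<lambda>j. if j = 0 then 1 else 0)"
  using thin_arrow_zero[of M p C] thin_top_notin[of M p C] thin_dim[of M p C p]
  by (auto simp: is_top_def)

lemma thin_is_soc:
  assumes M: "thin M p C" and v: "v \<in> C \<or> v = p \<and> C = {}"
  shows "is_soc M v (\<lambda>j. if j = 0 then 1 else 0)"
proof -
  have "snd M b i j = 0" if "E_src b = v" for b i j
    using thin_arrow_zero[OF M, of b] thin_child[OF M] thin_top_notin[OF M] v that by fastforce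
  then show ?thesis using thin_dim[OF M, of v] v by (auto simp: is_soc_def)
qed

lemma thin_Hom_nonzero:
  fixes M M' :: "(nat \<times> nat, 'k::field) rep"
  assumes M: "thin M p C" and M': "thin M' q D" and "p \<in> D \<or> p = q \<and> D = {}"
  shows "dimHom V Ar E_src E_tgt M M' \<noteq> 0"
proof
  assume "dimHom V Ar E_src E_tgt M M' = 0"
  from Hom_eq_zero[OF this rank_one_in_Hom[OF thin_is_top[OF M] thin_is_soc[OF M' assms(3)]], of p 0 0]
  show False using M by (simp add: thin_def)
qed

lemma Z1_thin_support:
  assumes "thin M p C" "thin M' q D" "g \<in> Z1_rep Ar E_src E_tgt M M'" "g a i j \<noteq> 0"
  shows "a \<in> Ar" "i = 0" "j = 0" "E_tgt a \<in> insert q D" "E_src a \<in> insert p C"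
proof -
  have "g \<in> afam Ar E_src E_tgt M M'" using assms(3) by (simp add: Z1_rep_def)
  then have "a \<notin> Ar \<longrightarrow> g a = (\<lambda>i j. 0)"
      and sup: "a \<in> Ar \<longrightarrow> supported (fst M' (E_tgt a)) (fst M (E_src a)) (g a)"
    unfolding afam_def by blast+
  then show "a \<in> Ar" using assms(4) by auto
  then have "supported (fst M' (E_tgt a)) (fst M (E_src a)) (g a)" using sup by blast
  then have "i < fst M' (E_tgt a)" "j < fst M (E_src a)"
    using supportedD[of _ _ "g a" i j] assms(4) by (auto simp flip: not_le)
  then show "i = 0" "j = 0" "E_tgt a \<in> insert q D" "E_src a \<in> insert p C"
    unfolding thin_dim[OF assms(1)] thin_dim[OF assms(2)] by (auto split: if_splits)
qed

text \<open>If the middle vertex lies outside the support of one module, the sum over it is empty,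
  and the cocycle value in that term is 0 as well. So one scalar equation covers all cases.\<close>

lemma Z1_thin_cocycle:
  assumes M: "thin M p C" and M': "thin M' q D" and g: "g \<in> Z1_rep Ar E_src E_tgt M M'"
    and ab: "a \<in> Ar" "b \<in> Ar" "E_tgt a = E_src b"
  shows "snd M' b 0 0 * g a 0 0 + g b 0 0 * snd M a 0 0 = 0"
proof -
  have "(\<lambda>i j. mmul (fst M' (E_src b)) (snd M' b) (g a) i j + mmul (fst M (E_src b)) (g b) (snd M a) i j)
      = (\<lambda>i j. 0)"
    using g ab by (simp add: Z1_rep_def)
  moreover have "g a 0 0 = 0" if "E_src b \<notin> insert q D"
    using Z1_thin_support(4)[OF M M' g, of a 0 0] ab(3) that by auto
  moreover have "g b 0 0 = 0" if "E_src b \<notin> insert p C"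
    using Z1_thin_support(5)[OF M M' g, of b 0 0] that by auto
  ultimately show ?thesis
    using mmul_thin[OF M, of "E_src b" "g b" "snd M a" 0 0]
      mmul_thin[OF M', of "E_src b" "snd M' b" "g a" 0 0]
    by (auto dest!: fun_cong[of _ _ 0] split: if_split_asm)
qed

lemma B1_thinI:
  assumes M: "thin M p C" and M': "thin M' q D" and g: "g \<in> Z1_rep Ar E_src E_tgt M M'"
    and x: "\<And>v. x v \<noteq> 0 \<Longrightarrow> v \<in> insert p C \<and> v \<in> insert q D"
    and eq: "\<And>a. a \<in> Ar \<Longrightarrow> g a 0 0 = snd M' a 0 0 * x (E_src a) - x (E_tgt a) * snd M a 0 0"
  shows "g \<in> B1_rep V Ar E_src E_tgt M M'"
proof -
  let ?h = "\<lambda>v i j :: nat. if i = 0 \<and> j = 0 then x v else 0"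
  have V: "insert p C \<subseteq> V" using M by (auto simp: thin_def E_verts_def)
  have "?h \<in> vfam V M M'"
    using x V by (auto simp: vfam_def supported_def thin_dim[OF M] thin_dim[OF M'] fun_eq_iff)
  moreover have "g a i j = (if a \<in> Ar then mmul (fst M' (E_src a)) (snd M' a) (?h (E_src a)) i j
      - mmul (fst M (E_tgt a)) (?h (E_tgt a)) (snd M a) i j else 0)" for a i j
  proof (cases "a \<in> Ar")
    case True
    have "mmul (fst M' (E_src a)) (snd M' a) (?h (E_src a)) i j = snd M' a i 0 * ?h (E_src a) 0 j"
      unfolding mmul_thin[OF M'] using x[of "E_src a"] by auto
    moreover have "mmul (fst M (E_tgt a)) (?h (E_tgt a)) (snd M a) i j = ?h (E_tgt a) i 0 * snd M a 0 j"
      unfolding mmul_thin[OF M] using x[of "E_tgt a"] by auto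
    ultimately show ?thesis
      using True eq[OF True] Z1_thin_support(2,3)[OF M M' g, of a i j]
        thin_arrow_entry[OF M, of 0 j a] thin_arrow_entry[OF M', of i 0 a]
      by (cases "i = 0 \<and> j = 0") auto
  qed (use Z1_thin_support(1)[OF M M' g, of a i j] in auto)
  ultimately show ?thesis unfolding B1_rep_def by (intro image_eqI[of _ _ ?h]) (auto simp: fun_eq_iff)
qed

text \<open>On a loop, the cocycle equation with a nonzero adjacent edge forces the value 0. On the
  edges of the star, the coboundary equation can be solved vertex by vertex.\<close>

lemma Ext_zero_same_top:
  fixes M M' :: "(nat \<times> nat, 'k::field) rep"
  assumes M: "thin M p C" and M': "thin M' p D" and "C \<noteq> {}" "D \<noteq> {}"
  shows "Z1_rep Ar E_src E_tgt M M' \<subseteq> B1_rep V Ar E_src E_tgt M M'"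
proof
  fix g assume g: "g \<in> Z1_rep Ar E_src E_tgt M M'"
  note supp = Z1_thin_support[OF M M' g]
  note cocycle = Z1_thin_cocycle[OF M M' g]
  \<comment> \<open>At a child in D outside C only the component at p can kill the cocycle. There is at most
    one such child, and the children in C then absorb the change.\<close>
  obtain y where y: "\<And>c. c \<in> D - C \<Longrightarrow> g (c, 0) 0 0 = snd M' (c, 0) 0 0 * y"
  proof (cases "D \<subseteq> C")
    case True
    then show ?thesis by (intro that[of 0]) auto
  next
    case False
    then obtain d where d: "d \<in> D - C" by blast
    obtain c where c: "c \<in> C" using \<open>C \<noteq> {}\<close> by blast
    have "e = d" if "e \<in> D - C" for e
      using E_at_most_two_children[of c d e p] thin_child[OF M] thin_child[OF M'] c d that by auto
    moreover have "snd M' (d, 0) 0 0 \<noteq> 0" using thin_arrow_iff[OF M'] d by auto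
    ultimately show ?thesis by (intro that[of "g (d, 0) 0 0 / snd M' (d, 0) 0 0"]) auto
  qed
  \<comment> \<open>For \<open>v\<close> in both \<open>C\<close> and \<open>D\<close> this solves
    \<open>g = M' x - x M\<close> on the edge from \<open>p\<close> to \<open>v\<close>, where the
    entry of \<open>M\<close> is nonzero.\<close>
  define x where "x v = (if v = p then y else if v \<in> C \<inter> D
      then (snd M' (v, 0) 0 0 * y - g (v, 0) 0 0) / snd M (v, 0) 0 0 else 0)" for v
  show "g \<in> B1_rep V Ar E_src E_tgt M M'"
  proof (rule B1_thinI[OF M M' g])
    show "v \<in> insert p C \<and> v \<in> insert p D" if "x v \<noteq> 0" for v
      using that by (auto simp: x_def split: if_splits)
    show "g a 0 0 = snd M' a 0 0 * x (E_src a) - x (E_tgt a) * snd M a 0 0" if "a \<in> Ar" for a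
      using that
    proof (cases rule: arrow_cases)
      case (edge v)
      consider "v \<in> C" "v \<in> D" | "v \<in> D" "v \<notin> C" | "v \<notin> D" by blast
      then show ?thesis
      proof cases
        case 1
        then show ?thesis
          using edge thin_child[OF M, of v] thin_arrow_iff[OF M, of a] E_parent_neq[of v] by (auto simp: x_def)
      next
        case 2
        then show ?thesis
          using edge thin_child[OF M', of v] thin_arrow_iff[OF M, of a] y[of v] by (auto simp: x_def)
      next
        case 3
        \<comment> \<open>A nonzero value would need \<open>v = p\<close> with its parent in the
          support of \<open>M\<close>, but the parent of \<open>p\<close> is shallower than
          \<open>p\<close>, while \<open>C\<close> is deeper.\<close>
        have "v \<noteq> p \<or> E_parent v \<notin> insert p C"
          using E_parent_neq[of v] E_depth_parent[of v] thin_child[OF M, of "E_parent v"]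
            E_depth_parent[of "E_parent v"] edge by auto
        then have "g a 0 0 = 0" using supp(4,5)[of a 0 0] 3 edge by auto
        moreover have "snd M' a 0 0 = 0" using thin_arrow_iff[OF M', of a] 3 edge by auto
        moreover have "x v * snd M a 0 0 = 0"
          using 3 thin_arrow_iff[OF M, of a] thin_top_notin[OF M] edge by (auto simp: x_def)
        ultimately show ?thesis using edge by simp
      qed
    next
      case (loop v k)
      have zero: "snd M a 0 0 = 0" "snd M' a 0 0 = 0"
        using thin_arrow_iff[OF M, of a] thin_arrow_iff[OF M', of a] loop by auto
      have "g a 0 0 = 0"
      proof (rule ccontr)
        assume nz: "g a 0 0 \<noteq> 0"
        then have "v \<in> insert p C" "v \<in> insert p D" using supp(4,5)[OF nz] loop by auto
        then consider "v = p" | "v \<in> C" "v \<in> D" by blast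
        then show False
        proof cases
          case 1
          obtain d where d: "d \<in> D" using \<open>D \<noteq> {}\<close> by blast
          then have "snd M' (d, 0) 0 0 \<noteq> 0" using thin_arrow_iff[OF M'] by auto
          then show False
            using cocycle[OF that, of "(d, 0)"] zero nz thin_child[OF M' d] 1 loop by auto
        next
          case 2
          then have "snd M (v, 0) 0 0 \<noteq> 0" using thin_arrow_iff[OF M] by auto
          then show False
            using cocycle[OF _ that, of "(v, 0)"] zero nz thin_child[OF M 2(1)] loop by auto
        qed
      qed
      then show ?thesis using zero by simp
    qed
  qed
qed

text \<open>For \<open>p \<noteq> q\<close> the cocycles themselves vanish. The depth hypothesis
  serves to exclude \<open>E_parent q = p\<close>, the edge that can carry a nonsplit
  extension.\<close>

lemma Ext_zero_of_depth:
  fixes M M' :: "(nat \<times> nat, 'k::field) rep"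
  assumes M: "thin M p C" and M': "thin M' q D"
    and Hom: "dimHom V Ar E_src E_tgt M M' = 0" "dimHom V Ar E_src E_tgt M' M = 0"
    and depth: "E_depth q \<noteq> Suc (E_depth p)"
  shows "Z1_rep Ar E_src E_tgt M M' \<subseteq> B1_rep V Ar E_src E_tgt M M'"
proof (cases "p = q")
  case True
  have "C \<noteq> {}" "D \<noteq> {}"
    using thin_Hom_nonzero[OF M M'] thin_Hom_nonzero[OF M' M] Hom True by auto
  then show ?thesis using Ext_zero_same_top[OF M M'[folded True]] by blast
next
  case False
  have "p \<notin> D" "q \<notin> C" using thin_Hom_nonzero[OF M M'] thin_Hom_nonzero[OF M' M] Hom by auto
  show ?thesis
  proof
    fix g assume g: "g \<in> Z1_rep Ar E_src E_tgt M M'"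
    note supp = Z1_thin_support[OF M M' g]
    have "g a 0 0 = 0" if a: "a \<in> Ar" for a
    proof (rule ccontr)
      assume nz: "g a 0 0 \<noteq> 0"
      show False using a
      proof (cases rule: arrow_cases)
        case (edge v)
        have v: "v \<in> insert q D" and u: "E_parent v \<in> insert p C" using supp(4,5)[OF nz] edge by auto
        have "v \<notin> D" using u thin_child[OF M', of v] False \<open>q \<notin> C\<close> by auto
        then have vq: "v = q" using v by simp
        \<comment> \<open>Now \<open>M\<close> has a nonzero edge into the source of
          \<open>a\<close>, while \<open>M'\<close> is zero on \<open>a\<close>; the cocycle
          equation for this pair leaves only the product of \<open>g a\<close> with that nonzero
          entry.\<close>
        then have "E_parent v \<in> C" using u depth E_depth_parent[of v] edge by auto
        then have "snd M (E_parent v, 0) 0 0 \<noteq> 0" "(E_parent v, 0) \<in> Ar"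
          using thin_arrow_iff[OF M] thin_child[OF M] by auto
        moreover have "snd M' a 0 0 = 0" using thin_arrow_iff[OF M', of a] edge \<open>v \<notin> D\<close> by auto
        ultimately show False
          using Z1_thin_cocycle[OF M M' g _ a, of "(E_parent v, 0)"] nz edge by auto
      next
        case (loop v k)
        then have "v \<in> insert q D" "v \<in> insert p C" using supp(4,5)[OF nz] by auto
        then have "v \<in> C" "v \<in> D" using False \<open>p \<notin> D\<close> \<open>q \<notin> C\<close> by auto
        then show False using thin_child[OF M] thin_child[OF M'] False by auto
      qed
    qed
    then show "g \<in> B1_rep V Ar E_src E_tgt M M'"
      by (intro B1_thinI[OF M M' g, of "\<lambda>v. 0"]) auto
  qed
qed

lemma Z1_simple_support:
  assumes M: "thin M p {}" and g: "g \<in> Z1_rep Ar E_src E_tgt M M" and nz: "g a i j \<noteq> 0"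
  shows "(a, i, j) \<in> (\<lambda>k. ((p, Suc k), 0, 0)) ` {..<N p}"
proof -
  note supp = Z1_thin_support[OF M M g nz]
  from supp(1) show ?thesis
  proof (cases rule: arrow_cases)
    case (edge v)
    then show ?thesis using supp(4,5) E_parent_neq[of v] by auto
  next
    case (loop v k)
    then show ?thesis using supp by auto
  qed
qed

lemma dimExt1_self_le:
  fixes M :: "(nat \<times> nat, 'k::field) rep"
  assumes M: "thin M p C"
  shows "dimExt1 V Ar E_src E_tgt M M \<le> N p"
proof (cases "C = {}")
  case False
  then show ?thesis
    using dimExt1_eq_0I[OF Ext_zero_same_top[OF M M False False]] thin_rep[OF M] by simp
next
  case True
  have "kdim (Z1_rep Ar E_src E_tgt M M) \<le> card ((\<lambda>k. ((p, Suc k), 0 :: nat, 0 :: nat)) ` {..<N p})"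
    using Z1_simple_support[OF M[unfolded True]] by (intro kdim_fsupp_le) blast+
  also have "\<dots> \<le> N p" using card_image_le[of "{..<N p}"] by simp
  finally show ?thesis by (simp add: dimExt1_def)
qed

section \<open>Simple modules and their self-extensions\<close>

definition E_simple :: "nat \<Rightarrow> (nat \<times> nat, 'k::field) rep" where
  "E_simple p = (\<lambda>v. if v = p then 1 else 0, \<lambda>a i j. 0)"

lemma thin_E_simple: "p \<in> V \<Longrightarrow> thin (E_simple p) p {}"
  by (auto simp: thin_def is_rep_def E_simple_def mmul_def supported_def)

lemma is_brick_E_simple:
  assumes p: "p \<in> V"
  shows "is_brick V Ar E_src E_tgt (E_simple p :: (nat \<times> nat, 'k::field) rep)"
proof -
  have "h x i j = 0" if h: "h \<in> Hom_rep V Ar E_src E_tgt (E_simple p) (E_simple p)"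
    and "(x, i, j) \<notin> {(p, 0, 0)}" for h :: "nat \<Rightarrow> nat \<Rightarrow> nat \<Rightarrow> 'k" and x i j
  proof (cases "x \<in> V")
    case True
    then have "supported (if x = p then 1 else 0) (if x = p then 1 else 0) (h x)"
      using h by (simp add: Hom_rep_def vfam_def E_simple_def)
    then show ?thesis using that(2) by (auto simp: supported_def split: if_splits)
  qed (use h in \<open>simp add: Hom_rep_def vfam_def\<close>)
  moreover have "h \<in> Hom_rep V Ar E_src E_tgt (E_simple p) (E_simple p)"
    if "\<forall>x i j. (x, i, j) \<notin> {(p, 0, 0)} \<longrightarrow> h x i j = 0" for h :: "nat \<Rightarrow> nat \<Rightarrow> nat \<Rightarrow> 'k"
  proof -
    have off: "h v = (\<lambda>i j. 0)" if "v \<noteq> p" for v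
      using \<open>\<forall>x i j. _\<close> that by (auto simp: fun_eq_iff)
    have "supported (if v = p then 1 else 0) (if v = p then 1 else 0) (h v)" for v
      using that by (auto simp: supported_def)
    moreover have "h v = (\<lambda>i j. 0)" if "v \<notin> V" for v
      using off[of v] that p by blast
    ultimately show ?thesis by (simp add: Hom_rep_def vfam_def E_simple_def mmul_def)
  qed
  ultimately have "Hom_rep V Ar E_src E_tgt (E_simple p) (E_simple p :: (nat \<times> nat, 'k) rep)
      = {h. \<forall>x i j. (x, i, j) \<notin> {(p, 0, 0)} \<longrightarrow> h x i j = 0}"
    by blast
  then have "dimHom V Ar E_src E_tgt (E_simple p) (E_simple p :: (nat \<times> nat, 'k) rep) = 1"
    using kdim_fsupp[of "{(p, 0, 0)}"] by (simp add: dimHom_def)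
  then show ?thesis
    using p thin_rep[OF thin_E_simple[OF p]] by (auto simp: is_brick_def nonzero_rep_def E_simple_def)
qed

text \<open>All arrows act by 0, so every admissible family is a cocycle and every coboundary is 0;
  only the loops at \<open>p\<close> have both ends in the support.\<close>

lemma dimExt1_E_simple:
  assumes p: "p \<in> V"
  shows "dimExt1 V Ar E_src E_tgt (E_simple p) (E_simple p :: (nat \<times> nat, 'k::field) rep) = N p"
proof -
  let ?M = "E_simple p :: (nat \<times> nat, 'k) rep"
  let ?K = "(\<lambda>k. ((p, Suc k), 0 :: nat, 0 :: nat)) ` {..<N p}"
  have "g \<in> Z1_rep Ar E_src E_tgt ?M ?M" if g: "\<forall>a i j. (a, i, j) \<notin> ?K \<longrightarrow> g a i j = 0" for g
  proof -
    have loop: "\<exists>k<N p. a = (p, Suc k) \<and> i = 0 \<and> j = 0" if "g a i j \<noteq> 0" for a i j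
      using g that by blast
    have "g a = (\<lambda>i j. 0)" if "a \<notin> Ar" for a
    proof (intro ext, rule ccontr)
      fix i j assume "g a i j \<noteq> 0"
      from loop[OF this] show False using that p by (auto simp: E_verts_def)
    qed
    moreover have "supported (fst ?M (E_tgt a)) (fst ?M (E_src a)) (g a)" for a
      unfolding supported_def
    proof (intro allI impI, rule ccontr)
      fix i j assume *: "fst ?M (E_tgt a) \<le> i \<or> fst ?M (E_src a) \<le> j" and "g a i j \<noteq> 0"
      from loop[OF this(2)] show False using * by (auto simp: E_simple_def)
    qed
    ultimately show ?thesis by (simp add: Z1_rep_def afam_def E_simple_def)
  qed
  then have "Z1_rep Ar E_src E_tgt ?M ?M = {g. \<forall>a i j. (a, i, j) \<notin> ?K \<longrightarrow> g a i j = 0}"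
    using Z1_simple_support[OF thin_E_simple[OF p]] by blast
  then have "kdim (Z1_rep Ar E_src E_tgt ?M ?M) = N p"
    by (simp only: kdim_fsupp finite_imageI finite_lessThan) (simp add: card_image inj_on_def)
  moreover have "kdim (B1_rep V Ar E_src E_tgt ?M ?M) \<le> card ({} :: ((nat \<times> nat) \<times> nat \<times> nat) set)"
    by (rule kdim_fsupp_le) (auto simp: B1_rep_def E_simple_def mmul_def)
  ultimately show ?thesis by (simp add: dimExt1_def)
qed

section \<open>Spectral radii of brick sets: upper bound and attainment\<close>

lemma spectral_radius_brick_set_le:
  fixes X :: "(nat \<times> nat, 'k::field) rep list"
  assumes X: "is_brick_set V Ar E_src E_tgt X"
  shows "spectral_radius (adj_mat V Ar E_src E_tgt X) \<le> real (Max (N ` {1..n}))"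
proof -
  have "\<forall>i. \<exists>p C. i < length X \<longrightarrow> thin (X ! i) p C"
    using X brick_thin unfolding is_brick_set_def by metis
  then obtain p C where thin: "\<And>i. i < length X \<Longrightarrow> thin (X ! i) (p i) (C i)" by metis
  show ?thesis
  proof (rule spectral_radius_le_of_graded[of _ "length X" _ "\<lambda>i. E_depth (p i)"])
    show "adj_mat V Ar E_src E_tgt X \<in> carrier_mat (length X) (length X)" by (simp add: adj_mat_def)
    show "0 < length X" using X by (simp add: is_brick_set_def)
  next
    fix i assume i: "i < length X"
    then have "p i \<in> {1..n}" using thin[OF i] by (simp add: thin_def E_verts_def)
    then have "N (p i) \<le> Max (N ` {1..n})" by (intro Max_ge) auto
    then have "dimExt1 V Ar E_src E_tgt (X ! i) (X ! i) \<le> Max (N ` {1..n})"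
      using dimExt1_self_le[OF thin[OF i]] by linarith
    then show "norm (adj_mat V Ar E_src E_tgt X $$ (i, i)) \<le> real (Max (N ` {1..n}))"
      using i by (simp add: adj_mat_def)
  next
    fix i j
    assume ij: "i < length X" "j < length X" "i \<noteq> j" and nz: "adj_mat V Ar E_src E_tgt X $$ (i, j) \<noteq> 0"
    have "dimHom V Ar E_src E_tgt (X ! i) (X ! j) = 0" "dimHom V Ar E_src E_tgt (X ! j) (X ! i) = 0"
      using X ij by (auto simp: is_brick_set_def)
    note Ext = Ext_zero_of_depth[OF thin[OF ij(1)] thin[OF ij(2)] this]
    have "dimExt1 V Ar E_src E_tgt (X ! i) (X ! j) \<noteq> 0" using nz ij by (simp add: adj_mat_def)
    then have "E_depth (p j) = Suc (E_depth (p i))"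
      using dimExt1_eq_0I[OF Ext thin_rep[OF thin[OF ij(1)]] thin_rep[OF thin[OF ij(2)]]]
      by (rule contrapos_np)
    then show "E_depth (p i) < E_depth (p j)" by simp
  qed
qed

lemma spectral_radius_E_simple_ge:
  assumes p: "p \<in> V"
  shows "real (N p) \<le> spectral_radius (adj_mat V Ar E_src E_tgt [E_simple p :: (nat \<times> nat, 'k::field) rep])"
proof -
  let ?A = "adj_mat V Ar E_src E_tgt [E_simple p :: (nat \<times> nat, 'k) rep]"
  have A: "?A \<in> carrier_mat 1 1" by (simp add: adj_mat_def)
  have "?A *\<^sub>v vec 1 (\<lambda>_. 1) = of_nat (N p) \<cdot>\<^sub>v vec 1 (\<lambda>_. 1)"
    by (rule eq_vecI) (auto simp: adj_mat_def scalar_prod_def dimExt1_E_simple[OF p])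
  moreover have "vec 1 (\<lambda>_. 1 :: complex) \<noteq> 0\<^sub>v 1"
  proof
    assume "vec 1 (\<lambda>_. 1 :: complex) = 0\<^sub>v 1"
    from arg_cong[OF this, of "\<lambda>v. v $ 0"] show False by simp
  qed
  ultimately have "eigenvalue ?A (of_nat (N p))"
    using A unfolding eigenvalue_def eigenvector_def by (intro exI[of _ "vec 1 (\<lambda>_. 1)"]) auto
  then have "norm (of_nat (N p) :: complex) \<in> norm ` spectrum ?A"
    by (intro imageI) (simp add: spectrum_def)
  from spectral_radius_mem_max(2)[OF A _ this] show ?thesis by simp
qed

end

theorem theorem5p3:
  fixes n :: nat and N :: "nat \<Rightarrow> nat"
  assumes "n \<in> {6, 7, 8}"
  shows "fpd TYPE('k::alg_closed_field) (E_verts n) (E_arrows n N) E_src E_tgt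
           = ereal (real (Max (N ` {1..n})))"
proof -
  interpret E_quiver n N using assms by unfold_locales auto
  show ?thesis unfolding fpd_def
  proof (rule antisym)
    show "(SUP X \<in> {X :: (nat \<times> nat, 'k) rep list. is_brick_set V Ar E_src E_tgt X}.
        ereal (spectral_radius (adj_mat V Ar E_src E_tgt X))) \<le> ereal (real (Max (N ` {1..n})))"
    proof (rule SUP_least)
      fix X :: "(nat \<times> nat, 'k) rep list"
      assume "X \<in> {X. is_brick_set V Ar E_src E_tgt X}"
      then show "ereal (spectral_radius (adj_mat V Ar E_src E_tgt X)) \<le> ereal (real (Max (N ` {1..n})))"
        using spectral_radius_brick_set_le[of X] by simp
    qed
    \<comment> \<open>The bound is attained by the one-element brick set formed by the simple module
      at a vertex with the most loops.\<close>
    have "Max (N ` {1..n}) \<in> N ` {1..n}" using n_ge_4 by (intro Max_in) auto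
    then obtain p where p: "p \<in> V" "Max (N ` {1..n}) = N p" by (auto simp: E_verts_def)
    show "ereal (real (Max (N ` {1..n}))) \<le> (SUP X \<in> {X :: (nat \<times> nat, 'k) rep list.
        is_brick_set V Ar E_src E_tgt X}. ereal (spectral_radius (adj_mat V Ar E_src E_tgt X)))"
    proof (rule SUP_upper2)
      show "[E_simple p :: (nat \<times> nat, 'k) rep] \<in> {X. is_brick_set V Ar E_src E_tgt X}"
        using is_brick_E_simple[OF p(1), where 'k = 'k] by (simp add: is_brick_set_def)
      show "ereal (real (Max (N ` {1..n}))) \<le> ereal (spectral_radius
          (adj_mat V Ar E_src E_tgt [E_simple p :: (nat \<times> nat, 'k) rep]))"
        using spectral_radius_E_simple_ge[OF p(1), where 'k = 'k] p(2) by simp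
    qed
  qed
qed

end
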